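(* Let $G$ be a compact metrizable abelian group with Haar probability measure $m_G$ and let $\chi_1,\dots,\chi_m\in\widehat G$ be distinct characters. For every $a\in\mathbb C^m$, $$q_{G,\chi}(a)=\sup_{c\in\mathbb C^m,\ c\ne0}\frac{|\langle a,c\rangle|}{\lambda_{G,\chi}(c)}.$$ The infimum defining $q_{G,\chi}(a)$ is attained in $L^\infty(G)$. For every $\eta>0$ there is also $f\in C(G)$ with coefficients $\int_Gf\overline{\chi_j}\,dm_G=a_j$ for $1\le j\le m$ and $$\|f\|_\infty\le q_{G,\chi}(a)+\eta.$$
   Context: The Hermitian pairing is $\langle a,c\rangle=\sum_{j=1}^ma_j\overline{c_j}$. For $c\in\mathbb C^m$, $P_c=\sum_{j=1}^mc_j\chi_j$ and $\lambda_{G,\chi}(c)=\int_G|P_c|\,dm_G$. The compact-group interpolation norm is $$q_{G,\chi}(a)=\inf\Bigl\{\|f\|_{L^\infty(G)}:\ f\in L^\infty(G),\ \int_Gf\overline{\chi_j}\,dm_G=a_j\ (1\le j\le m)\Bigr\}.$$ All functions are complex valued. *)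

theory Defs
  imports "HOL-Probability.Probability_Measure" "HOL-Probability.Essential_Supremum"
begin

text \<open>The compact abelian group \<open>G\<close> is the whole type \<open>'g\<close>, written additively.  Its Haar
  probability measure is taken on the Borel sets; being unique, it is given as a measure with
  the defining properties.\<close>

definition haar_prob :: "'g::topological_ab_group_add measure \<Rightarrow> bool" where
  "haar_prob M \<longleftrightarrow>
     prob_space M \<and> sets M = sets borel \<and>
     (\<forall>x. \<forall>A \<in> sets M. emeasure M ((+) x ` A) = emeasure M A)"

definition group_character :: "('g::topological_ab_group_add \<Rightarrow> complex) \<Rightarrow> bool" where
  "group_character chi \<longleftrightarrow>
     continuous_on UNIV chi \<and> (\<forall>x. cmod (chi x) = 1) \<and> (\<forall>x y. chi (x + y) = chi x * chi y)"

definition hpair :: "complex ^ 'm::finite \<Rightarrow> complex ^ 'm \<Rightarrow> complex" where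
  "hpair a c = (\<Sum>j\<in>UNIV. a $ j * cnj (c $ j))"

definition trig_poly :: "('m::finite \<Rightarrow> 'g \<Rightarrow> complex) \<Rightarrow> complex ^ 'm \<Rightarrow> 'g \<Rightarrow> complex" where
  "trig_poly chi c x = (\<Sum>j\<in>UNIV. c $ j * chi j x)"

definition L1_norm_poly ::
    "'g measure \<Rightarrow> ('m::finite \<Rightarrow> 'g \<Rightarrow> complex) \<Rightarrow> complex ^ 'm \<Rightarrow> real" where
  "L1_norm_poly M chi c = (\<integral>x. cmod (trig_poly chi c x) \<partial>M)"

text \<open>The norm is \<open>ereal\<close>-valued; the essential supremum of a function that is not
  essentially bounded is \<open>\<infinity>\<close>.  Elements of \<open>L\<^sup>\<infinity>\<close> are given by representatives.\<close>

definition Linf_norm :: "'g measure \<Rightarrow> ('g \<Rightarrow> complex) \<Rightarrow> ereal" where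
  "Linf_norm M f = esssup M (\<lambda>x. ereal (cmod (f x)))"

definition Linf :: "'g measure \<Rightarrow> ('g \<Rightarrow> complex) set" where
  "Linf M = {f \<in> borel_measurable M. Linf_norm M f < \<infinity>}"

definition has_coeffs ::
    "'g measure \<Rightarrow> ('m::finite \<Rightarrow> 'g \<Rightarrow> complex) \<Rightarrow> complex ^ 'm \<Rightarrow> ('g \<Rightarrow> complex) \<Rightarrow> bool" where
  "has_coeffs M chi a f \<longleftrightarrow> (\<forall>j. (\<integral>x. f x * cnj (chi j x) \<partial>M) = a $ j)"

text \<open>An infimum in \<open>ereal\<close>, so no nonemptiness of the set of interpolants is presupposed.\<close>

definition interp_norm ::
    "'g measure \<Rightarrow> ('m::finite \<Rightarrow> 'g \<Rightarrow> complex) \<Rightarrow> complex ^ 'm \<Rightarrow> ereal" where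
  "interp_norm M chi a = (INF f \<in> {f \<in> Linf M. has_coeffs M chi a f}. Linf_norm M f)"

end

theory Submission
  imports Defs
begin

text \<open>Write \<open>\<lambda>(c)\<close> for the \<open>L\<^sup>1\<close> norm of \<open>P\<^sub>c = \<Sum>\<^sub>j c\<^sub>j \<chi>\<^sub>j\<close>.  If \<open>f\<close> has coefficients \<open>a\<close>, then
  \<open>\<langle>a,c\<rangle> = \<integral> f cnj P\<^sub>c\<close>, so \<open>|\<langle>a,c\<rangle>| \<le> \<parallel>f\<parallel>\<^sub>\<infinity> \<lambda>(c)\<close>; this is the easy half of the duality.  The converse
  half is a separation argument in the finite-dimensional space of coefficient vectors.

  Translation invariance of Haar measure makes distinct characters orthonormal
  (\<open>group_character_orthonormal\<close>).  Hence each \<open>c\<^sub>j\<close> is an integral of \<open>P\<^sub>c\<close> against a unimodular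
  function, so \<open>|c\<^sub>j| \<le> \<lambda>(c)\<close>.  It follows that \<open>\<lambda>(c) > 0\<close> for \<open>c \<noteq> 0\<close> and that the supremum of the ratios is a
  finite number \<open>N\<close>.

  The coefficient vectors of continuous functions bounded by 1 form a convex set \<open>K\<close>.  Testing with
  the continuous functions \<open>P\<^sub>c / (|P\<^sub>c| + \<epsilon>)\<close> shows that any upper bound of the functional
  \<open>v \<mapsto> Re \<langle>v,c\<rangle>\<close> on \<open>K\<close> is at least \<open>\<lambda>(c)\<close>.  If \<open>a / (N + \<eta>)\<close> were outside \<open>K\<close>, a separating
  hyperplane would give some \<open>c \<noteq> 0\<close> with \<open>\<lambda>(c) \<le> Re \<langle>a,c\<rangle> / (N + \<eta>) \<le> N \<lambda>(c) / (N + \<eta>) < \<lambda>(c)\<close>.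
  So a continuous interpolant of norm at most \<open>N + \<eta>\<close> exists for every \<open>\<eta> > 0\<close>
  (\<open>continuous_interpolation\<close>).

  For attainment, the interpolants bounded by \<open>N + 1/n\<close> form a decreasing sequence of nonempty
  convex sets.  Functions of nearly minimal \<open>L\<^sup>2\<close> norm in these sets are Cauchy by the parallelogram
  law, and a suitable choice of them converges almost everywhere
  (\<open>decseq_convex_AE_convergent_selection\<close>).  By dominated convergence the limit has coefficients
  \<open>a\<close>, and it is bounded by \<open>N\<close> almost everywhere (\<open>bounded_interpolation\<close>).\<close>

section \<open>Nested convex sets of bounded functions\<close>

text \<open>The parallelogram law, arranged so that two points of nearly minimal norm in a convex set are
  seen to be close: their midpoint lies in the set and cannot be much shorter than they are.\<close>

lemma norm_diff_half_square:
  fixes x y :: complex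
  shows "(cmod (x - y))\<^sup>2 = 2 * (cmod x)\<^sup>2 + 2 * (cmod y)\<^sup>2 - 4 * (cmod ((x + y) / 2))\<^sup>2"
  unfolding cmod_power2 by (simp add: power2_eq_square field_simps)

text \<open>The sum of the increments has a finite integral, so it is finite almost everywhere; where it
  is finite, the increments sum absolutely and the sequence telescopes to a limit.\<close>

lemma (in prob_space) AE_convergent_if_L1_geometric:
  fixes f :: "nat \<Rightarrow> 'a \<Rightarrow> complex"
  assumes int: "\<And>n. integrable M (f n)"
    and geo: "\<And>n. (\<integral>x. cmod (f (Suc n) x - f n x) \<partial>M) \<le> K * (1/2) ^ n"
  shows "AE x in M. convergent (\<lambda>n. f n x)"
proof -
  have [measurable]: "f n \<in> borel_measurable M" for n
    using int by auto
  define D where "D n x = cmod (f (Suc n) x - f n x)" for n x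
  have Dint: "integrable M (D n)" for n
    unfolding D_def using int by auto
  have K: "0 \<le> K"
    using order_trans[OF integral_nonneg_AE geo[of 0]] by simp
  have "(\<integral>\<^sup>+x. (\<Sum>n. ennreal (D n x)) \<partial>M) = (\<Sum>n. \<integral>\<^sup>+x. ennreal (D n x) \<partial>M)"
    by (rule nn_integral_suminf) (simp add: D_def)
  also have "\<dots> \<le> (\<Sum>n. ennreal (K * (1/2) ^ n))"
  proof (intro suminf_le)
    fix n
    have "(\<integral>\<^sup>+x. ennreal (D n x) \<partial>M) = ennreal (\<integral>x. D n x \<partial>M)"
      by (rule nn_integral_eq_integral[OF Dint]) (simp add: D_def)
    also have "\<dots> \<le> ennreal (K * (1/2) ^ n)"
      using geo[of n] by (intro ennreal_leI) (simp add: D_def)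
    finally show "(\<integral>\<^sup>+x. ennreal (D n x) \<partial>M) \<le> ennreal (K * (1/2) ^ n)" .
  qed auto
  also have "\<dots> = ennreal (\<Sum>n. K * (1/2) ^ n)"
    by (rule suminf_ennreal2) (use K in \<open>auto intro!: summable_mult summable_geometric\<close>)
  also have "\<dots> < \<infinity>" by simp
  finally have "(\<integral>\<^sup>+x. (\<Sum>n. ennreal (D n x)) \<partial>M) \<noteq> \<infinity>" by simp
  then have "AE x in M. (\<Sum>n. ennreal (D n x)) \<noteq> \<infinity>"
    by (intro nn_integral_PInf_AE) (auto simp: D_def)
  then show ?thesis
  proof (eventually_elim)
    case (elim x)
    then have "summable (\<lambda>n. D n x)"
      by (intro summable_suminf_not_top) (auto simp: D_def)
    then have "summable (\<lambda>n. f (Suc n) x - f n x)"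
      unfolding D_def by (rule summable_norm_cancel)
    then have "convergent (\<lambda>n. \<Sum>i<n. f (Suc i) x - f i x)"
      by (simp add: summable_iff_convergent)
    then have "convergent (\<lambda>n. f n x - f 0 x)"
      unfolding sum_lessThan_telescope[of "\<lambda>n. f n x"] .
    then have "convergent (\<lambda>n. (f n x - f 0 x) + f 0 x)"
      by (intro convergent_add convergent_const)
    then show ?case by simp
  qed
qed

text \<open>A form of weak compactness in \<open>L\<^sup>2\<close>.  The infima \<open>d n\<close> of the squared \<open>L\<^sup>2\<close> norm over \<open>C n\<close>
  increase to a limit \<open>L\<close>.  Near-minimizers taken far enough along the sequence have pairwise
  midpoints whose energy is still close to \<open>L\<close>, so the parallelogram law makes consecutive ones
  close in \<open>L\<^sup>2\<close>, hence in \<open>L\<^sup>1\<close>.\<close>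

lemma (in prob_space) decseq_convex_AE_convergent_selection:
  fixes C :: "nat \<Rightarrow> ('a \<Rightarrow> complex) set"
  assumes dec: "decseq C"
    and ne: "\<And>n. C n \<noteq> {}"
    and meas: "\<And>n f. f \<in> C n \<Longrightarrow> f \<in> borel_measurable M"
    and bound: "\<And>n f x. f \<in> C n \<Longrightarrow> x \<in> space M \<Longrightarrow> cmod (f x) \<le> B"
    and mid: "\<And>n f g. f \<in> C n \<Longrightarrow> g \<in> C n \<Longrightarrow> (\<lambda>x. (f x + g x) / 2) \<in> C n"
  shows "\<exists>f. (\<forall>n. f n \<in> C n) \<and> (AE x in M. convergent (\<lambda>n. f n x))"
proof -
  define E where "E f = (\<integral>x. (cmod (f x))\<^sup>2 \<partial>M)" for f :: "'a \<Rightarrow> complex"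
  define d where "d n = (INF f\<in>C n. E f)" for n
  define L where "L = (SUP n. d n)"
  have int: "integrable M f" if "f \<in> C n" for f n
    using meas[OF that] bound[OF that] by (intro integrable_const_bound[of _ B]) auto
  have int2: "integrable M (\<lambda>x. (cmod (f x))\<^sup>2)" if "f \<in> C n" for f n
    using meas[OF that] bound[OF that]
    by (intro integrable_const_bound[of _ "B\<^sup>2"]) (auto intro!: power_mono)
  have E_nonneg: "0 \<le> E f" for f unfolding E_def by simp
  have bdd: "bdd_below (E ` C n)" for n
    by (intro bdd_belowI2[of _ 0] E_nonneg)
  have d_le: "d n \<le> E f" if "f \<in> C n" for f n
    unfolding d_def by (rule cINF_lower[OF bdd that])
  have d_mono: "d m \<le> d n" if "m \<le> n" for m n
    unfolding d_def using decseqD[OF dec that] ne bdd by (intro cINF_superset_mono) auto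
  have E_bd: "E f \<le> B\<^sup>2" if "f \<in> C n" for f n
  proof -
    have "E f \<le> (\<integral>x. B\<^sup>2 \<partial>M)" unfolding E_def
      using bound[OF that] by (intro integral_mono int2[OF that]) (auto intro!: power_mono)
    then show ?thesis by (simp add: prob_space)
  qed
  have bddL: "bdd_above (range d)"
  proof (rule bdd_aboveI2)
    fix n show "d n \<le> B\<^sup>2" using ne[of n] d_le E_bd by (meson all_not_in_conv order_trans)
  qed
  have d_L: "d n \<le> L" for n unfolding L_def by (rule cSUP_upper[OF _ bddL]) simp
  \<comment> \<open>The tolerance \<open>(1/4)^k\<close> in squared norm becomes \<open>(1/2)^k\<close> in norm, which is summable.\<close>
  have "\<exists>n f. k \<le> n \<and> L - (1/4)^k < d n \<and> f \<in> C n \<and> E f < L + (1/4)^k" for k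
  proof -
    have "L - (1/4)^k < L" by simp
    then obtain n0 where n0: "L - (1/4)^k < d n0"
      unfolding L_def less_cSUP_iff[OF UNIV_not_empty bddL] by auto
    define n where "n = max n0 k"
    have n: "k \<le> n" "L - (1/4)^k < d n"
      using n0 d_mono[of n0 n] by (auto simp: n_def)
    have "d n < L + (1/4)^k" using d_L[of n] by (simp add: add_strict_increasing2 le_less_trans)
    then obtain f where "f \<in> C n" "E f < L + (1/4)^k"
      unfolding d_def cINF_less_iff[OF ne bdd] by auto
    with n show ?thesis by blast
  qed
  then obtain N f where N: "\<And>k. k \<le> N k" "\<And>k. L - (1/4)^k < d (N k)"
    and f: "\<And>k. f k \<in> C (N k)" "\<And>k. E (f k) < L + (1/4)^k"
    by metis
  have geo: "(\<integral>x. cmod (f (Suc k) x - f k x) \<partial>M) \<le> 9/2 * (1/2) ^ k" for k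
  proof -
    \<comment> \<open>\<open>N\<close> need not be monotone, so the midpoint is only known to lie in the larger set.\<close>
    define n where "n = min (N k) (N (Suc k))"
    have in_n: "f k \<in> C n" "f (Suc k) \<in> C n"
      using f(1)[of k] f(1)[of "Suc k"] decseqD[OF dec, of n "N k"] decseqD[OF dec, of n "N (Suc k)"]
      by (auto simp: n_def)
    have dn: "L - (1/4)^k < d n"
    proof -
      have "L - (1/4)^k \<le> L - (1/4)^Suc k" by simp
      moreover have "n = N k \<or> n = N (Suc k)" by (simp add: n_def min_def)
      ultimately show ?thesis using N(2)[of k] N(2)[of "Suc k"] by (metis le_less_trans)
    qed
    define h where "h x = (f (Suc k) x + f k x) / 2" for x
    have h: "h \<in> C n" unfolding h_def by (rule mid[OF in_n(2) in_n(1)])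
    have sq: "(\<integral>x. (cmod (f (Suc k) x - f k x))\<^sup>2 \<partial>M) = 2 * E (f (Suc k)) + 2 * E (f k) - 4 * E h"
      unfolding E_def norm_diff_half_square h_def[symmetric]
      using int2[OF in_n(1)] int2[OF in_n(2)] int2[OF h] by simp
    have i2: "integrable M (\<lambda>x. (cmod (f (Suc k) x - f k x))\<^sup>2)"
      unfolding norm_diff_half_square h_def[symmetric]
      using int2[OF in_n(1)] int2[OF in_n(2)] int2[OF h] by simp
    have "(1/4::real)^Suc k \<le> (1/4)^k" by simp
    then have sq_le: "(\<integral>x. (cmod (f (Suc k) x - f k x))\<^sup>2 \<partial>M) \<le> 8 * (1/4)^k"
      using sq f(2)[of k] f(2)[of "Suc k"] d_le[OF h] dn by linarith
    \<comment> \<open>A weighted arithmetic-geometric mean inequality passes from \<open>L\<^sup>2\<close> to \<open>L\<^sup>1\<close>; the weight \<open>2\<^sup>k\<close> balances the two terms.\<close>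
    have pt: "t \<le> (1/2) * (1/2)^k + (1/2) * 2^k * t\<^sup>2" for t :: real
    proof -
      have "0 \<le> 2^k * (t - (1/2)^k)\<^sup>2" by simp
      also have "\<dots> = 2^k * t\<^sup>2 - 2 * t + (1/2)^k"
        by (simp add: power2_eq_square algebra_simps power_one_over)
      finally show ?thesis by simp
    qed
    have "(\<integral>x. cmod (f (Suc k) x - f k x) \<partial>M)
        \<le> (\<integral>x. (1/2) * (1/2)^k + (1/2) * 2^k * (cmod (f (Suc k) x - f k x))\<^sup>2 \<partial>M)"
      using int[OF in_n(1)] int[OF in_n(2)] i2 pt by (intro integral_mono) auto
    also have "\<dots> = (1/2) * (1/2)^k + (1/2) * 2^k * (\<integral>x. (cmod (f (Suc k) x - f k x))\<^sup>2 \<partial>M)"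
      using i2 by (simp add: prob_space)
    also have "\<dots> \<le> (1/2) * (1/2)^k + (1/2) * 2^k * (8 * (1/4)^k)"
      using sq_le by (intro add_left_mono mult_left_mono) auto
    also have "\<dots> = 9/2 * (1/2) ^ k"
    proof -
      have "(2::real)^k * (1/4)^k = (1/2)^k" unfolding power_mult_distrib[symmetric] by simp
      then show ?thesis by simp
    qed
    finally show ?thesis .
  qed
  have "AE x in M. convergent (\<lambda>n. f n x)"
    by (rule AE_convergent_if_L1_geometric[OF int[OF f(1)] geo])
  moreover have "f n \<in> C n" for n
    using f(1)[of n] decseqD[OF dec N(1)[of n]] by auto
  ultimately show ?thesis by blast
qed

section \<open>Orthogonality of characters\<close>

lemma group_characterD:
  assumes "group_character chi"
  shows "continuous_on UNIV chi" "cmod (chi x) = 1" "chi (x + y) = chi x * chi y"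
  using assms by (auto simp: group_character_def)

text \<open>Invariance is assumed for images of sets; the preimage under translation by \<open>y\<close> that the
  push-forward needs is the image under translation by \<open>- y\<close>.\<close>

lemma haar_prob_distr_translation:
  fixes M :: "'g::topological_ab_group_add measure"
  assumes "haar_prob M"
  shows "distr M M ((+) y) = M" and "(+) y \<in> measurable M M"
proof -
  have sets: "sets M = sets borel"
    and inv: "\<And>x A. A \<in> sets M \<Longrightarrow> emeasure M ((+) x ` A) = emeasure M A"
    using assms by (auto simp: haar_prob_def)
  have "(+) y \<in> borel_measurable borel"
    by (intro borel_measurable_continuous_onI continuous_intros)
  then show meas: "(+) y \<in> measurable M M"
    by (simp add: measurable_cong_sets[OF sets sets])
  show "distr M M ((+) y) = M"
  proof (rule measure_eqI)
    fix A assume "A \<in> sets (distr M M ((+) y))"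
    then have A: "A \<in> sets M" by simp
    have "space M = UNIV" using sets_eq_imp_space_eq[OF sets] by simp
    moreover have "(+) y -` A = (+) (- y) ` A" by (force simp: image_iff)
    ultimately show "emeasure (distr M M ((+) y)) A = emeasure M A"
      using emeasure_distr[OF meas A] inv[OF A, of "- y"] by simp
  qed simp
qed

text \<open>Translating by a point \<open>y\<close> multiplies the integral of the character \<open>\<phi> cnj \<psi>\<close> by its value at
  \<open>y\<close>.  If \<open>\<phi>\<close> and \<open>\<psi>\<close> differ at \<open>y\<close> this factor is not 1, and the integral must vanish.\<close>

lemma group_character_orthonormal:
  fixes M :: "'g::topological_ab_group_add measure"
  assumes M: "haar_prob M" and c: "group_character \<phi>" "group_character \<psi>"
  shows "(\<integral>x. \<phi> x * cnj (\<psi> x) \<partial>M) = (if \<phi> = \<psi> then 1 else 0)"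
proof -
  interpret prob_space M using M by (simp add: haar_prob_def)
  have sets: "sets M = sets borel" using M by (simp add: haar_prob_def)
  have unit: "\<psi> x * cnj (\<psi> x) = 1" for x
    using group_characterD(2)[OF c(2), of x] by (simp add: complex_mult_cnj cmod_def flip: of_real_power)
  show ?thesis
  proof (cases "\<phi> = \<psi>")
    case True
    then show ?thesis by (simp add: unit prob_space)
  next
    case False
    then obtain y where y: "\<phi> y \<noteq> \<psi> y" by auto
    define F where "F x = \<phi> x * cnj (\<psi> x)" for x
    have "continuous_on UNIV F"
      unfolding F_def using group_characterD(1)[OF c(1)] group_characterD(1)[OF c(2)]
      by (intro continuous_intros)
    then have meas: "F \<in> borel_measurable M"
      using borel_measurable_continuous_onI measurable_cong_sets[OF sets refl] by blast
    have "F y * \<psi> y = \<phi> y" using unit[of y] by (simp add: F_def algebra_simps)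
    with y have Fy: "F y \<noteq> 1" by auto
    have "(\<integral>x. F x \<partial>M) = (\<integral>x. F x \<partial>distr M M ((+) y))"
      by (simp add: haar_prob_distr_translation(1)[OF M])
    also have "\<dots> = (\<integral>x. F (y + x) \<partial>M)"
      by (rule integral_distr[OF haar_prob_distr_translation(2)[OF M] meas])
    also have "\<dots> = (\<integral>x. F y * F x \<partial>M)"
      by (simp add: F_def group_characterD(3)[OF c(1)] group_characterD(3)[OF c(2)] mult_ac)
    also have "\<dots> = F y * (\<integral>x. F x \<partial>M)" by simp
    finally have "(\<integral>x. F x \<partial>M) = 0" using Fy by simp
    then show ?thesis using False by (simp add: F_def)
  qed
qed

section \<open>Interpolation by bounded functions\<close>

text \<open>This turns separating hyperplanes for the real inner product on the coefficient space into
  statements about the Hermitian pairing.\<close>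

lemma inner_eq_Re_hpair: "c \<bullet> a = Re (hpair a c)"
  by (simp add: inner_vec_def hpair_def inner_complex_def mult.commute)

lemma Linf_norm_le_iff:
  assumes "f \<in> borel_measurable M"
  shows "Linf_norm M f \<le> ereal B \<longleftrightarrow> (AE x in M. cmod (f x) \<le> B)"
proof
  assume le: "Linf_norm M f \<le> ereal B"
  have "AE x in M. ereal (cmod (f x)) \<le> Linf_norm M f"
    unfolding Linf_norm_def by (rule esssup_AE)
  then show "AE x in M. cmod (f x) \<le> B"
  proof eventually_elim
    case (elim x)
    then show ?case using order_trans[OF elim le] by simp
  qed
next
  assume "AE x in M. cmod (f x) \<le> B"
  then show "Linf_norm M f \<le> ereal B"
    unfolding Linf_norm_def using assms by (intro esssup_I) auto
qed

text \<open>Characters enter the duality as continuous functions of modulus 1 that are orthonormal; the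
  locale abstracts these properties.\<close>

locale orthonormal_unimodular = prob_space M
  for M :: "'g::topological_space measure" +
  fixes chi :: "'m::finite \<Rightarrow> 'g \<Rightarrow> complex"
  assumes sets_borel: "sets M = sets borel"
    and continuous: "continuous_on UNIV (chi j)"
    and unimodular: "cmod (chi j x) = 1"
    and orthonormal: "(\<integral>x. chi i x * cnj (chi j x) \<partial>M) = (if i = j then 1 else 0)"
begin

lemma measurable_continuous:
  "continuous_on UNIV f \<Longrightarrow> f \<in> borel_measurable M" for f :: "'g \<Rightarrow> complex"
  using borel_measurable_continuous_onI measurable_cong_sets[OF sets_borel refl] by blast

lemma chi_measurable [measurable]: "chi j \<in> borel_measurable M"
  by (rule measurable_continuous[OF continuous])

lemma cnj_chi_measurable [measurable]: "(\<lambda>x. cnj (chi j x)) \<in> borel_measurable M"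
  by (rule measurable_continuous[OF continuous_on_cnj[OF continuous]])

lemma continuous_trig_poly: "continuous_on UNIV (trig_poly chi c)"
  unfolding trig_poly_def by (intro continuous_intros continuous)

lemma trig_poly_measurable [measurable]: "trig_poly chi c \<in> borel_measurable M"
  by (rule measurable_continuous[OF continuous_trig_poly])

lemma cmod_trig_poly_le: "cmod (trig_poly chi c x) \<le> (\<Sum>j\<in>UNIV. cmod (c $ j))"
  unfolding trig_poly_def by (rule order_trans[OF norm_sum]) (simp add: norm_mult unimodular)

lemma integrable_trig_poly: "integrable M (trig_poly chi c)"
  using cmod_trig_poly_le[of c] by (intro integrable_const_bound) auto

lemma integrable_mult_bounded:
  fixes f g :: "'g \<Rightarrow> complex"
  assumes "f \<in> borel_measurable M" "AE x in M. cmod (f x) \<le> B" "integrable M g"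
  shows "integrable M (\<lambda>x. f x * g x)"
proof (rule Bochner_Integration.integrable_bound)
  show "integrable M (\<lambda>x. B * cmod (g x))" using assms by simp
  show "(\<lambda>x. f x * g x) \<in> borel_measurable M" using assms by auto
  show "AE x in M. norm (f x * g x) \<le> norm (B * cmod (g x))"
    using assms(2)
  proof eventually_elim
    case (elim x)
    then show ?case by (auto simp: norm_mult abs_mult intro!: mult_right_mono)
  qed
qed

lemma integrable_chi: "integrable M (\<lambda>x. cnj (chi j x))"
  by (intro integrable_const_bound[of _ 1]) (auto simp: unimodular)

lemma hpair_eq_integral:
  assumes f: "f \<in> borel_measurable M" "AE x in M. cmod (f x) \<le> B" and a: "has_coeffs M chi a f"
  shows "hpair a c = (\<integral>x. f x * cnj (trig_poly chi c x) \<partial>M)"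
proof -
  have "hpair a c = (\<Sum>j\<in>UNIV. (\<integral>x. f x * cnj (chi j x) \<partial>M) * cnj (c $ j))"
    using a by (simp add: hpair_def has_coeffs_def)
  also have "\<dots> = (\<Sum>j\<in>UNIV. \<integral>x. f x * cnj (chi j x) * cnj (c $ j) \<partial>M)" by simp
  also have "\<dots> = (\<integral>x. (\<Sum>j\<in>UNIV. f x * cnj (chi j x) * cnj (c $ j)) \<partial>M)"
    by (rule Bochner_Integration.integral_sum[symmetric])
       (intro integrable_mult_left integrable_mult_bounded[OF f integrable_chi])
  also have "\<dots> = (\<integral>x. f x * cnj (trig_poly chi c x) \<partial>M)"
    by (simp add: trig_poly_def sum_distrib_left mult_ac)
  finally show ?thesis .
qed

lemma cmod_hpair_le:
  assumes f: "f \<in> borel_measurable M" "AE x in M. cmod (f x) \<le> B" and a: "has_coeffs M chi a f"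
  shows "cmod (hpair a c) \<le> B * L1_norm_poly M chi c"
proof -
  have "cmod (hpair a c) \<le> (\<integral>x. norm (f x * cnj (trig_poly chi c x)) \<partial>M)"
    unfolding hpair_eq_integral[OF assms] by (rule integral_norm_bound)
  also have "\<dots> \<le> (\<integral>x. B * cmod (trig_poly chi c x) \<partial>M)"
  proof (rule integral_mono_AE)
    show "integrable M (\<lambda>x. norm (f x * cnj (trig_poly chi c x)))"
      by (intro integrable_norm integrable_mult_bounded[OF f]) (simp add: integrable_trig_poly)
    show "integrable M (\<lambda>x. B * cmod (trig_poly chi c x))"
      using integrable_trig_poly by simp
  next
    show "AE x in M. norm (f x * cnj (trig_poly chi c x)) \<le> B * cmod (trig_poly chi c x)"
      using f(2) by eventually_elim (auto simp: norm_mult intro!: mult_right_mono)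
  qed
  finally show ?thesis by (simp add: L1_norm_poly_def)
qed

lemma has_coeffs_trig_poly: "has_coeffs M chi c (trig_poly chi c)"
  unfolding has_coeffs_def
proof
  fix j
  have "(\<integral>x. trig_poly chi c x * cnj (chi j x) \<partial>M) =
      (\<integral>x. (\<Sum>i\<in>UNIV. c $ i * (chi i x * cnj (chi j x))) \<partial>M)"
    by (simp add: trig_poly_def sum_distrib_right mult.assoc)
  also have "\<dots> = (\<Sum>i\<in>UNIV. \<integral>x. c $ i * (chi i x * cnj (chi j x)) \<partial>M)"
    by (rule Bochner_Integration.integral_sum)
       (intro integrable_mult_right integrable_mult_bounded[of _ 1] chi_measurable integrable_chi;
        simp add: unimodular)
  also have "\<dots> = c $ j" by (simp add: orthonormal if_distrib cong: if_cong)
  finally show "(\<integral>x. trig_poly chi c x * cnj (chi j x) \<partial>M) = c $ j" .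
qed

text \<open>The coefficient is an integral of the polynomial against a function of modulus 1.  This makes
  the \<open>L\<^sup>1\<close> seminorm a norm on coefficient vectors.\<close>

lemma cmod_coeff_le_L1_norm: "cmod (c $ j) \<le> L1_norm_poly M chi c"
proof -
  have "c $ j = (\<integral>x. trig_poly chi c x * cnj (chi j x) \<partial>M)"
    using has_coeffs_trig_poly by (simp add: has_coeffs_def)
  also have "cmod \<dots> \<le> (\<integral>x. norm (trig_poly chi c x * cnj (chi j x)) \<partial>M)"
    by (rule integral_norm_bound)
  finally show ?thesis by (simp add: norm_mult unimodular L1_norm_poly_def)
qed

lemma L1_norm_pos: "c \<noteq> 0 \<Longrightarrow> 0 < L1_norm_poly M chi c"
  using cmod_coeff_le_L1_norm[of c] by (metis less_le_trans vec_eq_iff zero_index zero_less_norm_iff)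

lemma cmod_hpair_le_sum: "cmod (hpair a c) \<le> (\<Sum>j\<in>UNIV. cmod (a $ j)) * L1_norm_poly M chi c"
  unfolding hpair_def sum_distrib_right
  by (rule order_trans[OF norm_sum])
     (auto simp: norm_mult intro!: sum_mono mult_left_mono cmod_coeff_le_L1_norm)

text \<open>The separation argument.  The convex set \<open>coeffs ` U\<close> may fail to be closed, so a point
  outside it is only weakly separated from it; strict positivity of \<open>\<eta>\<close> supplies the gap that makes
  the weak inequalities contradictory.\<close>

lemma continuous_interpolation:
  assumes N: "0 \<le> N" and bd: "\<And>c. cmod (hpair a c) \<le> N * L1_norm_poly M chi c" and \<eta>: "0 < \<eta>"
  obtains f where "continuous_on UNIV f" "has_coeffs M chi a f" "\<And>x. cmod (f x) \<le> N + \<eta>"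
proof -
  define U where "U = {f :: 'g \<Rightarrow> complex. continuous_on UNIV f \<and> (\<forall>x. cmod (f x) \<le> 1)}"
  define coeffs where "coeffs f = (\<chi> j. \<integral>x. f x * cnj (chi j x) \<partial>M)" for f
  have coeffs: "has_coeffs M chi (coeffs f) f" for f
    by (simp add: has_coeffs_def coeffs_def)
  have int: "integrable M (\<lambda>x. f x * cnj (chi j x))" if "f \<in> U" for f j
    using that by (intro integrable_mult_bounded[of _ 1] integrable_chi measurable_continuous)
                  (auto simp: U_def)
  have conv: "convex (coeffs ` U)"
  proof (rule convexI)
    fix x y and u v :: real
    assume "x \<in> coeffs ` U" "y \<in> coeffs ` U" and uv: "0 \<le> u" "0 \<le> v" "u + v = 1"
    then obtain f g where fg: "f \<in> U" "g \<in> U" "x = coeffs f" "y = coeffs g" by auto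
    define h where "h z = u *\<^sub>R f z + v *\<^sub>R g z" for z
    have "cmod (h z) \<le> 1" for z
    proof -
      have "cmod (h z) \<le> u * cmod (f z) + v * cmod (g z)"
        unfolding h_def using uv by (intro order_trans[OF norm_triangle_ineq]) simp
      also have "\<dots> \<le> u * 1 + v * 1"
        using uv fg by (intro add_mono mult_left_mono) (auto simp: U_def)
      finally show ?thesis using uv by simp
    qed
    moreover have "continuous_on UNIV h"
      unfolding h_def using fg by (auto simp: U_def intro!: continuous_intros)
    ultimately have "h \<in> U" by (simp add: U_def)
    moreover have "coeffs h = u *\<^sub>R x + v *\<^sub>R y"
      using int[OF fg(1)] int[OF fg(2)]
      by (simp add: vec_eq_iff coeffs_def fg h_def ring_distribs)
    ultimately show "u *\<^sub>R x + v *\<^sub>R y \<in> coeffs ` U" by (metis image_eqI)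
  qed
  have "(1 / (N + \<eta>)) *\<^sub>R a \<in> coeffs ` U"
  proof (rule ccontr)
    assume notin: "(1 / (N + \<eta>)) *\<^sub>R a \<notin> coeffs ` U"
    have "(\<lambda>_. 0) \<in> U" by (simp add: U_def)
    then have ne: "coeffs ` U \<noteq> {}" by blast
    obtain c b where c: "c \<noteq> 0" "\<And>v. v \<in> coeffs ` U \<Longrightarrow> c \<bullet> v \<le> b"
      "b \<le> c \<bullet> ((1 / (N + \<eta>)) *\<^sub>R a)"
      using separating_hyperplane_sets[OF conv convex_singleton ne, of "(1 / (N + \<eta>)) *\<^sub>R a"] notin
      by auto
    define l where "l = L1_norm_poly M chi c"
    have l: "0 < l" unfolding l_def by (rule L1_norm_pos[OF c(1)])
    have "l \<le> b"
    proof (rule field_le_epsilon)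
      fix e :: real assume e: "0 < e"
      \<comment> \<open>\<open>f\<close> is a continuous approximation of the sign of \<open>P\<close>; it satisfies
        \<open>f cnj P = |P|\<^sup>2 / (|P| + e) \<ge> |P| - e\<close>.\<close>
      define P where "P = trig_poly chi c"
      define f where "f x = P x / of_real (cmod (P x) + e)" for x
      have pos: "0 < cmod (P x) + e" for x using e by (simp add: add_nonneg_pos)
      have "continuous_on UNIV f"
        unfolding f_def P_def using pos
        by (intro continuous_intros continuous_trig_poly)
           (simp add: P_def less_imp_neq[symmetric] del: of_real_add)
      moreover have f1: "cmod (f x) \<le> 1" for x
        using pos[of x] e by (simp add: f_def norm_divide del: of_real_add)
      ultimately have fU: "f \<in> U" by (simp add: U_def)
      then have fm: "f \<in> borel_measurable M" by (auto simp: U_def intro: measurable_continuous)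
      have fP: "f x * cnj (P x) = of_real ((cmod (P x))\<^sup>2 / (cmod (P x) + e))" for x
        by (simp add: f_def complex_norm_square[symmetric] of_real_divide del: of_real_add)
      have fi: "integrable M (\<lambda>x. f x * cnj (P x))"
        using f1 by (intro integrable_mult_bounded[OF fm, of 1]) (auto simp: P_def integrable_trig_poly)
      have "c \<bullet> coeffs f = Re (\<integral>x. f x * cnj (P x) \<partial>M)"
        unfolding inner_eq_Re_hpair P_def
        using hpair_eq_integral[OF fm _ coeffs, of 1] f1 by simp
      also have "\<dots> = (\<integral>x. Re (f x * cnj (P x)) \<partial>M)"
        by (rule integral_Re[OF fi, symmetric])
      also have "\<dots> \<ge> (\<integral>x. cmod (P x) - e \<partial>M)"
      proof (rule integral_mono)
        show "integrable M (\<lambda>x. cmod (P x) - e)" by (simp add: P_def integrable_trig_poly)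
        show "integrable M (\<lambda>x. Re (f x * cnj (P x)))" using fi by (rule integrable_Re)
        fix x
        have "(cmod (P x) - e) * (cmod (P x) + e) \<le> (cmod (P x))\<^sup>2"
          by (simp add: algebra_simps power2_eq_square)
        then show "cmod (P x) - e \<le> Re (f x * cnj (P x))"
          unfolding fP Re_complex_of_real using pos[of x] by (simp add: le_divide_eq)
      qed
      also have "(\<integral>x. cmod (P x) - e \<partial>M) = l - e"
        by (simp add: P_def l_def L1_norm_poly_def integrable_trig_poly prob_space)
      finally show "l \<le> b + e" using c(2)[of "coeffs f"] fU by auto
    qed
    also have "b \<le> (1 / (N + \<eta>)) * (c \<bullet> a)" using c(3) by simp
    also have "c \<bullet> a \<le> N * l"
      unfolding inner_eq_Re_hpair l_def
      by (rule order_trans[OF complex_Re_le_cmod bd])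
    finally have "l \<le> 1 / (N + \<eta>) * (N * l)"
      using N \<eta> by (simp add: mult_left_mono divide_right_mono)
    then show False using N \<eta> l mult_pos_pos[OF \<eta> l] by (simp add: field_simps)
  qed
  then obtain g where g: "g \<in> U" "coeffs g = (1 / (N + \<eta>)) *\<^sub>R a" by auto
  define f where "f x = (N + \<eta>) *\<^sub>R g x" for x
  show ?thesis
  proof
    show "continuous_on UNIV f"
      unfolding f_def using g(1) by (auto simp: U_def intro!: continuous_intros)
    show "cmod (f x) \<le> N + \<eta>" for x
      using g(1) N \<eta> by (auto simp: U_def f_def intro!: mult_left_le)
    have "(\<integral>x. f x * cnj (chi j x) \<partial>M) = a $ j" for j
    proof -
      have "(\<integral>x. f x * cnj (chi j x) \<partial>M) = (N + \<eta>) *\<^sub>R (coeffs g $ j)"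
        by (simp add: f_def coeffs_def)
      also have "\<dots> = a $ j" using N \<eta> by (simp add: g(2))
      finally show ?thesis .
    qed
    then show "has_coeffs M chi a f" by (simp add: has_coeffs_def)
  qed
qed

lemma has_coeffs_midpoint:
  assumes f: "f \<in> borel_measurable M" "AE x in M. cmod (f x) \<le> B" "has_coeffs M chi a f"
    and g: "g \<in> borel_measurable M" "AE x in M. cmod (g x) \<le> B" "has_coeffs M chi a g"
  shows "has_coeffs M chi a (\<lambda>x. (f x + g x) / 2)"
proof -
  have "(\<integral>x. (f x + g x) / 2 * cnj (chi j x) \<partial>M) = a $ j" for j
  proof -
    have "(\<integral>x. (f x + g x) / 2 * cnj (chi j x) \<partial>M) =
        (\<integral>x. (f x * cnj (chi j x) + g x * cnj (chi j x)) / 2 \<partial>M)"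
      by (simp add: algebra_simps)
    also have "\<dots> = a $ j"
      using f(3) g(3) integrable_mult_bounded[OF f(1,2) integrable_chi[of j]]
        integrable_mult_bounded[OF g(1,2) integrable_chi[of j]]
      by (simp add: has_coeffs_def)
    finally show ?thesis .
  qed
  then show ?thesis by (simp add: has_coeffs_def)
qed

text \<open>Letting \<open>\<eta>\<close> tend to 0 costs continuity but attains the bound \<open>N\<close>: the constraints are convex and
  stable under bounded almost everywhere convergence.\<close>

lemma bounded_interpolation:
  assumes N: "0 \<le> N" and bd: "\<And>c. cmod (hpair a c) \<le> N * L1_norm_poly M chi c"
  obtains g where "g \<in> borel_measurable M" "has_coeffs M chi a g" "AE x in M. cmod (g x) \<le> N"
proof -
  define C where "C n = {f \<in> borel_measurable M. has_coeffs M chi a f \<and>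
      (\<forall>x. cmod (f x) \<le> N + inverse (real (Suc n)))}" for n
  have dec: "decseq C"
  proof (rule decseq_SucI)
    fix n
    have "inverse (real (Suc (Suc n))) \<le> inverse (real (Suc n))"
      by (intro le_imp_inverse_le) auto
    then show "C (Suc n) \<subseteq> C n" unfolding C_def by (auto intro: order_trans)
  qed
  have ne: "C n \<noteq> {}" for n
  proof -
    obtain f where "continuous_on UNIV f" "has_coeffs M chi a f"
        "\<And>x. cmod (f x) \<le> N + inverse (real (Suc n))"
      using continuous_interpolation[OF N bd, of "inverse (real (Suc n))"] by auto
    then have "f \<in> C n" by (auto simp: C_def intro: measurable_continuous)
    then show ?thesis by blast
  qed
  have meas: "f \<in> borel_measurable M" if "f \<in> C n" for f n using that by (simp add: C_def)
  have bound: "cmod (f x) \<le> N + 1" if "f \<in> C n" for f n x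
  proof -
    have "cmod (f x) \<le> N + inverse (real (Suc n))" using that by (simp add: C_def)
    also have "inverse (real (Suc n)) \<le> 1" by (simp add: inverse_le_1_iff)
    finally show ?thesis by simp
  qed
  have mid: "(\<lambda>x. (f x + g x) / 2) \<in> C n" if f: "f \<in> C n" and g: "g \<in> C n" for f g n
  proof -
    have "cmod ((f x + g x) / 2) \<le> N + inverse (real (Suc n))" for x
    proof -
      have "cmod (f x + g x) \<le> cmod (f x) + cmod (g x)" by (rule norm_triangle_ineq)
      also have "\<dots> \<le> 2 * (N + inverse (real (Suc n)))"
      proof -
        have "cmod (f x) \<le> N + inverse (real (Suc n))" "cmod (g x) \<le> N + inverse (real (Suc n))"
          using f g unfolding C_def by blast+
        then show ?thesis unfolding mult_2 by (rule add_mono)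
      qed
      finally show ?thesis unfolding norm_divide by simp
    qed
    moreover have "has_coeffs M chi a (\<lambda>x. (f x + g x) / 2)"
      using f g bound[OF f] bound[OF g]
      by (intro has_coeffs_midpoint[of f "N + 1" a g]) (auto simp: C_def)
    ultimately show ?thesis using meas[OF f] meas[OF g] by (simp add: C_def)
  qed
  have "\<exists>f. (\<forall>n. f n \<in> C n) \<and> (AE x in M. convergent (\<lambda>n. f n x))"
  proof (rule decseq_convex_AE_convergent_selection)
    show "decseq C" by (rule dec)
    show "C n \<noteq> {}" for n by (rule ne)
    show "f \<in> borel_measurable M" if "f \<in> C n" for n f using that by (rule meas)
    show "cmod (f x) \<le> N + 1" if "f \<in> C n" for n f x using that by (rule bound)
    show "(\<lambda>x. (f x + g x) / 2) \<in> C n" if "f \<in> C n" "g \<in> C n" for n f g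
      using that by (rule mid)
  qed
  then obtain f where f: "\<And>n. f n \<in> C n" and cv: "AE x in M. convergent (\<lambda>n. f n x)"
    by blast
  define g where "g x = lim (\<lambda>n. f n x)" for x
  have [measurable]: "f n \<in> borel_measurable M" for n by (rule meas[OF f])
  have gm [measurable]: "g \<in> borel_measurable M" unfolding g_def by measurable
  have lim: "AE x in M. (\<lambda>n. f n x) \<longlonglongrightarrow> g x"
    using cv by eventually_elim (simp add: g_def convergent_LIMSEQ_iff)
  have "has_coeffs M chi a g"
    unfolding has_coeffs_def
  proof
    fix j
    have "(\<lambda>n. \<integral>x. f n x * cnj (chi j x) \<partial>M) \<longlonglongrightarrow> (\<integral>x. g x * cnj (chi j x) \<partial>M)"
    proof (rule integral_dominated_convergence[where w = "\<lambda>_. N + 1"])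
      show "AE x in M. (\<lambda>n. f n x * cnj (chi j x)) \<longlonglongrightarrow> g x * cnj (chi j x)"
        using lim by eventually_elim (intro tendsto_intros)
    qed (auto simp: norm_mult unimodular intro: bound[OF f])
    moreover have "(\<integral>x. f n x * cnj (chi j x) \<partial>M) = a $ j" for n
      using f[of n] by (simp add: C_def has_coeffs_def)
    ultimately show "(\<integral>x. g x * cnj (chi j x) \<partial>M) = a $ j"
      by (simp add: LIMSEQ_const_iff)
  qed
  moreover have "AE x in M. cmod (g x) \<le> N"
    using lim
  proof eventually_elim
    case (elim x)
    have "(\<lambda>n. N + inverse (real (Suc n))) \<longlonglongrightarrow> N + 0"
      by (intro tendsto_intros LIMSEQ_inverse_real_of_nat)
    moreover have "cmod (f n x) \<le> N + inverse (real (Suc n))" for n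
      using f[of n] unfolding C_def by blast
    ultimately show ?case
      using tendsto_norm[OF elim] by (auto intro: LIMSEQ_le)
  qed
  ultimately show ?thesis using that gm by blast
qed

lemma le_Linf_norm:
  assumes f: "f \<in> Linf M" "has_coeffs M chi a f" and c: "c \<noteq> 0"
  shows "ereal (cmod (hpair a c)) / ereal (L1_norm_poly M chi c) \<le> Linf_norm M f"
proof -
  have meas: "f \<in> borel_measurable M"
    using f(1) by (simp add: Linf_def)
  have ratio: "cmod (hpair a c) / L1_norm_poly M chi c \<le> B" if "Linf_norm M f \<le> ereal B" for B
    using cmod_hpair_le[OF meas _ f(2), of B c] that L1_norm_pos[OF c]
    by (simp add: Linf_norm_le_iff[OF meas] divide_le_eq)
  have "ereal (cmod (hpair a c) / L1_norm_poly M chi c) \<le> Linf_norm M f"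
    by (rule ereal_le_real) (use ratio in \<open>simp only: ereal_less_eq(3)\<close>)
  then show ?thesis using L1_norm_pos[OF c] by simp
qed

text \<open>The supremum is first taken over the reals, where it is the bound \<open>N\<close> that the two
  interpolation lemmas need, and then identified with the extended real supremum.\<close>

theorem interpolation_duality:
  shows "interp_norm M chi a =
           (SUP c \<in> {c. c \<noteq> 0}. ereal (cmod (hpair a c)) / ereal (L1_norm_poly M chi c))"
    and "\<exists>f \<in> Linf M. has_coeffs M chi a f \<and> Linf_norm M f = interp_norm M chi a"
    and "0 < \<eta> \<Longrightarrow> \<exists>f. continuous_on UNIV f \<and> has_coeffs M chi a f \<and>
           (SUP x. ereal (cmod (f x))) \<le> interp_norm M chi a + ereal \<eta>"
proof -
  define N where "N = (SUP c\<in>{c. c \<noteq> 0}. cmod (hpair a c) / L1_norm_poly M chi c)"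
  have ne: "{c :: complex ^ 'm. c \<noteq> 0} \<noteq> {}"
    using zero_neq_one by blast
  have bdd: "bdd_above ((\<lambda>c. cmod (hpair a c) / L1_norm_poly M chi c) ` {c. c \<noteq> 0})"
    by (rule bdd_aboveI2[of _ _ "\<Sum>j\<in>UNIV. cmod (a $ j)"])
       (simp add: divide_le_eq L1_norm_pos cmod_hpair_le_sum)
  have le_N: "cmod (hpair a c) / L1_norm_poly M chi c \<le> N" if "c \<noteq> 0" for c
    unfolding N_def using that by (intro cSUP_upper[OF _ bdd]) simp
  have N: "0 \<le> N"
  proof -
    obtain c :: "complex ^ 'm" where "c \<noteq> 0" using ne by auto
    then show ?thesis using le_N[of c] L1_norm_pos[of c]
      by (meson divide_nonneg_pos norm_ge_zero order_trans)
  qed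
  have bd: "cmod (hpair a c) \<le> N * L1_norm_poly M chi c" for c
  proof (cases "c = 0")
    case True
    then show ?thesis by (simp add: hpair_def L1_norm_poly_def trig_poly_def)
  next
    case False
    then show ?thesis using le_N[OF False] L1_norm_pos[OF False] by (simp add: divide_le_eq)
  qed
  let ?S = "SUP c \<in> {c. c \<noteq> 0}. ereal (cmod (hpair a c)) / ereal (L1_norm_poly M chi c)"
  have S: "?S = ereal N"
  proof -
    have "?S = (SUP c \<in> {c. c \<noteq> 0}. ereal (cmod (hpair a c) / L1_norm_poly M chi c))"
      by (rule SUP_cong) (auto dest: L1_norm_pos)
    also have "\<dots> = ereal N"
    proof (rule antisym)
      show "(SUP c \<in> {c. c \<noteq> 0}. ereal (cmod (hpair a c) / L1_norm_poly M chi c)) \<le> ereal N"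
        using le_N by (intro SUP_least) simp
      show "ereal N \<le> (SUP c \<in> {c. c \<noteq> 0}. ereal (cmod (hpair a c) / L1_norm_poly M chi c))"
        (is "_ \<le> ?R")
      proof (rule ereal_le_real)
        fix z assume "?R \<le> ereal z"
        then have "\<forall>c\<in>{c. c \<noteq> 0}. cmod (hpair a c) / L1_norm_poly M chi c \<le> z"
          by (simp add: SUP_le_iff)
        then show "ereal N \<le> ereal z" unfolding N_def using ne by (auto intro: cSUP_least)
      qed
    qed
    finally show ?thesis .
  qed
  have low: "ereal N \<le> Linf_norm M f" if "f \<in> Linf M" "has_coeffs M chi a f" for f
    unfolding S[symmetric] using le_Linf_norm[OF that] by (intro SUP_least) simp
  obtain g where g: "g \<in> borel_measurable M" "has_coeffs M chi a g" "AE x in M. cmod (g x) \<le> N"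
    by (rule bounded_interpolation[OF N bd])
  have g_le: "Linf_norm M g \<le> ereal N" using g by (simp add: Linf_norm_le_iff)
  have gL: "g \<in> Linf M" using g(1) le_less_trans[OF g_le, of \<infinity>] by (simp add: Linf_def)
  have I: "interp_norm M chi a = ereal N"
    unfolding interp_norm_def
  proof (rule antisym)
    show "(INF f\<in>{f \<in> Linf M. has_coeffs M chi a f}. Linf_norm M f) \<le> ereal N"
      using gL g(2) g_le by (intro INF_lower2[of g]) auto
    show "ereal N \<le> (INF f\<in>{f \<in> Linf M. has_coeffs M chi a f}. Linf_norm M f)"
      using low by (intro INF_greatest) auto
  qed
  show "interp_norm M chi a = ?S" by (simp only: I S)
  show "\<exists>f \<in> Linf M. has_coeffs M chi a f \<and> Linf_norm M f = interp_norm M chi a"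
    unfolding I using gL g(2) g_le low[OF gL g(2)] by (intro bexI[of _ g]) auto
  show "\<exists>f. continuous_on UNIV f \<and> has_coeffs M chi a f \<and>
      (SUP x. ereal (cmod (f x))) \<le> interp_norm M chi a + ereal \<eta>" if \<eta>: "0 < \<eta>"
  proof -
    obtain f where "continuous_on UNIV f" "has_coeffs M chi a f" "\<And>x. cmod (f x) \<le> N + \<eta>"
      using continuous_interpolation[OF N bd \<eta>] by blast
    then show ?thesis unfolding I by (intro exI[of _ f]) (auto intro!: SUP_least)
  qed
qed

end

theorem theorem32p3:
  fixes M :: "'g::topological_ab_group_add measure"
    and chi :: "'m::finite \<Rightarrow> 'g \<Rightarrow> complex"
    and a :: "complex ^ 'm"
  assumes "compact (UNIV :: 'g set)"
    and "metrizable_space (euclidean :: 'g topology)"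
    and "haar_prob M"
    and "\<And>j. group_character (chi j)"
    and "inj chi"
  shows "interp_norm M chi a =
           (SUP c \<in> {c. c \<noteq> 0}. ereal (cmod (hpair a c)) / ereal (L1_norm_poly M chi c)) \<and>
         (\<exists>f \<in> Linf M. has_coeffs M chi a f \<and> Linf_norm M f = interp_norm M chi a) \<and>
         (\<forall>\<eta>::real. \<eta> > 0 \<longrightarrow>
           (\<exists>f. continuous_on UNIV f \<and> has_coeffs M chi a f \<and>
                (SUP x. ereal (cmod (f x))) \<le> interp_norm M chi a + ereal \<eta>))"
proof -
  interpret prob_space M using assms(3) by (simp add: haar_prob_def)
  interpret orthonormal_unimodular M chi
  proof
    show "sets M = sets borel" using assms(3) by (simp add: haar_prob_def)
    fix i j x
    show "continuous_on UNIV (chi j)" "cmod (chi j x) = 1"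
      using assms(4)[of j] by (auto dest: group_characterD)
    show "(\<integral>x. chi i x * cnj (chi j x) \<partial>M) = (if i = j then 1 else 0)"
      using group_character_orthonormal[OF assms(3,4,4)] inj_eq[OF assms(5)] by simp
  qed
  show ?thesis using interpolation_duality by blast
qed

end
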